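(* Let $\phi\in\{L,p_\tau\}$ and suppose $\phi$ is not identifiable over a class $\mathcal{N}$ of pairs on which $\phi$ is single-valued. Fix members $(F^0,K^0),(F^1,K^1)\in\mathcal{N}$ witnessing this failure, i.e. $K^0F^0=K^1F^1$ and $\phi(F^0)\ne\phi(F^1)$, and write $\Delta:=|\phi(F^0)-\phi(F^1)|>0$. Then for every sample size $n\ge 1$ and every Borel map $\hat\phi_n:[0,\infty]^n\to\mathbb{R}$, $$\sup_{(F_S,K)\in\mathcal{N}}\mathbb{E}_{Q^{\otimes n}}|\hat\phi_n-\phi(F_S)|\ge\tfrac12\Delta,\qquad\text{hence}\qquad \inf_{\hat\phi_n}\sup_{(F_S,K)\in\mathcal{N}}\mathbb{E}_{Q^{\otimes n}}|\hat\phi_n-\phi(F_S)|\ge\tfrac12\Delta>0,$$ where $Q=KF_S$ is the observed law of the member $(F_S,K)$ and $\mathbb{E}_{Q^{\otimes n}}$ denotes expectation when the sample $\tilde S_{1:n}\sim Q^{\otimes n}$ (expectations exist in $[0,\infty]$). Hence no estimator sequence is uniformly consistent for $\phi$ over $\mathcal{N}$. Moreover, since $\hat\phi_n(\tilde S_{1:n})$ has the same law under the two witnesses, no estimator sequence is pointwise consistent for $\phi$ at both $(F^0,K^0)$ and $(F^1,K^1)$.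
   Context: A pair $(F_S,K)$ consists of a Borel probability law $F_S$ on $[0,\infty)$ and a Markov kernel $K$ from $[0,\infty)$ to $[0,\infty]$; its observed law is the Borel probability $Q=KF_S$ on $[0,\infty]$, $Q(B)=\int K(B\mid s)F_S(ds)$. The functionals: $p_\tau(F_S)=F_S([0,\tau])$ for a fixed $\tau>0$; $L(F_S)$ is the constant in axiom A1, which says: $F_S(\{0\})=0$ and $F_S$ has a density $f_S$ on some $(0,s_0)$ with $f_S(s)=Ls^\alpha(1+o(1))$ pointwise as $s\downarrow 0$, for some $L\in(0,\infty)$, $\alpha\in[0,\infty)$. Under A1 the pair $(\alpha,L)$ is uniquely determined by $F_S$, so any class all of whose members satisfy A1 is one on which $\phi\in\{L,p_\tau\}$ is single-valued. Each $\phi$ depends on the pair only through $F_S$. $\phi$ is identifiable over $\mathcal{N}$ if for all $(F_S,K),(F_S',K')\in\mathcal{N}$ with $KF_S=K'F_S'$ one has $\phi(F_S)=\phi(F_S')$. An estimator is a sequence $(\hat\phi_n)_{n\ge 1}$ of Borel maps $\hat\phi_n:[0,\infty]^n\to\mathbb{R}$. It is uniformly consistent for $\phi$ over $\mathcal{N}$ in risk if $\sup_{\mathcal{N}}\mathbb{E}_{Q^{\otimes n}}|\hat\phi_n-\phi(F_S)|\to 0$, and in probability if $\sup_{\mathcal{N}}\mathbb{P}_{Q^{\otimes n}}(|\hat\phi_n-\phi(F_S)|\ge\varepsilon)\to 0$ for every $\varepsilon>0$ (the non-existence claim is meant in both senses). It is pointwise consistent at a member $(F_S,K)$ if $\mathbb{P}_{Q^{\otimes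 n}}(|\hat\phi_n-\phi(F_S)|\ge\varepsilon)\to 0$ as $n\to\infty$ for every $\varepsilon>0$, with $Q=KF_S$. *)

theory Defs
  imports "HOL-Probability.Probability"
begin

section \<open>Pairs and their observed laws\<close>

text \<open>Laws of the latent variable live on \<^term>\<open>restrict_space borel {0::real..}\<close>, i.e. on
  $[0,\infty)$, and observations live on \<^typ>\<open>ennreal\<close>, i.e. on $[0,\infty]$.  The values of a
  kernel outside $[0,\infty)$ are irrelevant.\<close>

abbreviation nonneg_borel :: "real measure" where
  "nonneg_borel \<equiv> restrict_space borel {0..}"

type_synonym law_kernel = "real measure \<times> (real \<Rightarrow> ennreal measure)"

definition is_pair :: "law_kernel \<Rightarrow> bool" where
  "is_pair P \<longleftrightarrow>
     fst P \<in> space (prob_algebra nonneg_borel) \<and>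
     snd P \<in> nonneg_borel \<rightarrow>\<^sub>M prob_algebra borel"

definition observed_law :: "law_kernel \<Rightarrow> ennreal measure" where
  "observed_law P = fst P \<bind> snd P"

lemma emeasure_observed_law:
  assumes "is_pair (F, K)" and "B \<in> sets borel"
  shows "emeasure (observed_law (F, K)) B = (\<integral>\<^sup>+ s. emeasure (K s) B \<partial>F)"
proof -
  have F: "sets F = sets nonneg_borel" "prob_space F"
    and K: "K \<in> nonneg_borel \<rightarrow>\<^sub>M prob_algebra borel"
    using assms(1) by (auto simp: is_pair_def space_prob_algebra)
  have "K \<in> F \<rightarrow>\<^sub>M subprob_algebra borel"
    using measurable_prob_algebraD[OF K] F(1) by (simp cong: measurable_cong_sets)
  then show ?thesis
    unfolding observed_law_def fst_conv snd_conv
    using prob_space.not_empty[OF F(2)] assms(2) by (intro emeasure_bind) auto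
qed

lemma prob_space_observed_law:
  assumes "is_pair (F, K)"
  shows "prob_space (observed_law (F, K))" and "sets (observed_law (F, K)) = sets borel"
  using assms prob_space_bind'[of F nonneg_borel K borel] sets_bind'[of F nonneg_borel K borel]
  by (auto simp: is_pair_def observed_law_def)


section \<open>The functionals\<close>

definition A1 :: "real measure \<Rightarrow> real \<Rightarrow> real \<Rightarrow> bool" where
  "A1 F \<alpha> L \<longleftrightarrow>
     0 \<le> \<alpha> \<and> 0 < L \<and> emeasure F {0} = 0 \<and>
     (\<exists>s\<^sub>0>0. \<exists>f\<in>borel_measurable borel.
        (\<forall>s\<in>{0<..<s\<^sub>0}. 0 \<le> f s) \<and>
        (\<forall>B\<in>sets borel. B \<subseteq> {0<..<s\<^sub>0} \<longrightarrow>
           emeasure F B = (\<integral>\<^sup>+ s\<in>B. ennreal (f s) \<partial>lborel)) \<and>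
        f \<sim>[at_right 0] (\<lambda>s. L * s powr \<alpha>))"

text \<open>A functional is represented by the relation between a law and its possible values, so that
  being single-valued over a class is a genuine condition.  The uniqueness of the constant in A1 is
  proved below.\<close>

type_synonym functional = "real measure \<Rightarrow> real \<Rightarrow> bool"

definition L_functional :: functional where
  "L_functional F v \<longleftrightarrow> (\<exists>\<alpha>. A1 F \<alpha> v)"

definition p_functional :: "real \<Rightarrow> functional" where
  "p_functional \<tau> F v \<longleftrightarrow> v = measure F {0..\<tau>}"

definition single_valued_over :: "functional \<Rightarrow> law_kernel set \<Rightarrow> bool" where
  "single_valued_over \<phi> N \<longleftrightarrow> (\<forall>P\<in>N. \<exists>!v. \<phi> (fst P) v)"

definition val :: "functional \<Rightarrow> law_kernel \<Rightarrow> real" where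
  "val \<phi> P = (THE v. \<phi> (fst P) v)"

definition identifiable :: "functional \<Rightarrow> law_kernel set \<Rightarrow> bool" where
  "identifiable \<phi> N \<longleftrightarrow>
     (\<forall>P\<in>N. \<forall>P'\<in>N. observed_law P = observed_law P' \<longrightarrow> val \<phi> P = val \<phi> P')"

lemma A1_unique_aux:
  fixes \<alpha> \<beta> L M :: real
  assumes G: "G \<le> at_right 0" "G \<noteq> bot" and LM: "0 < L" "0 < M"
    and eq: "(\<lambda>s. L * s powr \<alpha>) \<sim>[G] (\<lambda>s. M * s powr \<beta>)"
  shows "\<alpha> = \<beta> \<and> L = M"
proof -
  have pos: "eventually (\<lambda>s::real. 0 < s) G"
    using G(1) by (auto intro: filter_leD simp: eventually_at_right_less)
  have not_less: False
    if eq: "(\<lambda>s. L * s powr \<alpha>) \<sim>[G] (\<lambda>s. M * s powr \<beta>)" and "0 < M" and less: "\<beta> < \<alpha>"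
    for \<alpha> \<beta> L M :: real
  proof -
    have "((\<lambda>s. L * s powr \<alpha> / (M * s powr \<beta>)) \<longlongrightarrow> 1) G"
      by (rule asymp_equivD_strong[OF eq]) (use pos that(2) in \<open>auto elim!: eventually_mono\<close>)
    then have "((\<lambda>s. L / M * s powr (\<alpha> - \<beta>)) \<longlongrightarrow> 1) G"
      by (rule Lim_transform_eventually)
        (use pos in \<open>auto elim!: eventually_mono simp: powr_diff\<close>)
    moreover have "((\<lambda>s. L / M * s powr (\<alpha> - \<beta>)) \<longlongrightarrow> L / M * 0) (at_right 0)"
    proof (intro tendsto_mult tendsto_const)
      show "((\<lambda>s::real. s powr (\<alpha> - \<beta>)) \<longlongrightarrow> 0) (at_right 0)"
        using less by (intro tendsto_eq_intros)
          (auto simp: eventually_at_filter intro!: eventuallyI tendsto_ident_at)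
    qed
    then have "((\<lambda>s. L / M * s powr (\<alpha> - \<beta>)) \<longlongrightarrow> L / M * 0) G"
      using G(1) by (rule tendsto_mono[rotated])
    ultimately show False
      using tendsto_unique[OF G(2)] by fastforce
  qed
  have "\<alpha> = \<beta>"
    using not_less[OF eq] not_less[OF asymp_equiv_symI[OF eq]] LM by (cases \<alpha> \<beta> rule: linorder_cases) auto
  moreover have "((\<lambda>s. L * s powr \<alpha> / (M * s powr \<beta>)) \<longlongrightarrow> 1) G"
    by (rule asymp_equivD_strong[OF eq]) (use pos LM in \<open>auto elim!: eventually_mono\<close>)
  then have "((\<lambda>s. L / M) \<longlongrightarrow> 1) G"
    by (rule Lim_transform_eventually)
      (use eventually_mono[OF pos, of "\<lambda>s. L * s powr \<alpha> / (M * s powr \<beta>) = L / M"] \<open>\<alpha> = \<beta>\<close> in auto)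
  then have "L / M = 1"
    using G(2) by (simp add: tendsto_const_iff)
  ultimately show ?thesis using LM by simp
qed

lemma A1_unique:
  assumes "A1 F \<alpha> L" and "A1 F \<beta> M"
  shows "\<alpha> = \<beta> \<and> L = M"
proof -
  obtain r f where f: "0 < r" "f \<in> borel_measurable borel" "\<forall>s\<in>{0<..<r}. 0 \<le> f s"
      "\<And>B. B \<in> sets borel \<Longrightarrow> B \<subseteq> {0<..<r} \<Longrightarrow>
        emeasure F B = (\<integral>\<^sup>+ s\<in>B. ennreal (f s) \<partial>lborel)"
      "f \<sim>[at_right 0] (\<lambda>s. L * s powr \<alpha>)"
    using assms(1) unfolding A1_def by blast
  obtain q g where g: "0 < q" "g \<in> borel_measurable borel" "\<forall>s\<in>{0<..<q}. 0 \<le> g s"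
      "\<And>B. B \<in> sets borel \<Longrightarrow> B \<subseteq> {0<..<q} \<Longrightarrow>
        emeasure F B = (\<integral>\<^sup>+ s\<in>B. ennreal (g s) \<partial>lborel)"
      "g \<sim>[at_right 0] (\<lambda>s. M * s powr \<beta>)"
    using assms(2) unfolding A1_def by blast
  have LM: "0 < L" "0 < M" using assms by (auto simp: A1_def)
  define t where "t = min r q"
  define I where "I = {0<..<t}"
  have t: "0 < t" "I \<subseteq> {0<..<r}" "I \<subseteq> {0<..<q}" "I \<in> sets borel"
    using f(1) g(1) by (auto simp: t_def I_def)
  note [measurable] = f(2) g(2) t(4)
  have "density lborel (\<lambda>s. ennreal (f s) * indicator I s) =
        density lborel (\<lambda>s. ennreal (g s) * indicator I s)" (is "density _ ?f = density _ ?g")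
  proof (rule measure_eqI)
    fix A assume "A \<in> sets (density lborel ?f)"
    then have A[measurable]: "A \<in> sets borel" by simp
    have AI: "I \<inter> A \<in> sets borel" "I \<inter> A \<subseteq> {0<..<r}" "I \<inter> A \<subseteq> {0<..<q}"
      using t by auto
    have "emeasure (density lborel ?f) A = (\<integral>\<^sup>+ s\<in>I \<inter> A. ennreal (f s) \<partial>lborel)"
      by (subst emeasure_density) (auto simp: indicator_inter_arith mult.assoc)
    also have "\<dots> = (\<integral>\<^sup>+ s\<in>I \<inter> A. ennreal (g s) \<partial>lborel)"
      using f(4)[OF AI(1,2)] g(4)[OF AI(1,3)] by simp
    also have "\<dots> = emeasure (density lborel ?g) A"
      by (subst emeasure_density) (auto simp: indicator_inter_arith mult.assoc)
    finally show "emeasure (density lborel ?f) A = emeasure (density lborel ?g) A" .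
  qed simp
  then have AE: "AE s in lborel. ?f s = ?g s"
    by (intro sigma_finite_measure.density_unique[OF sigma_finite_lborel]) auto
  have AE': "AE s in lborel. s \<in> I \<longrightarrow> f s = g s"
    using AE
  proof eventually_elim
    case (elim s)
    show ?case
    proof
      assume "s \<in> I"
      then have "0 \<le> f s" "0 \<le> g s" using f(3) g(3) t by auto
      then show "f s = g s" using elim \<open>s \<in> I\<close> by (simp add: ennreal_inj)
    qed
  qed
  have freq: "frequently (\<lambda>s. f s = g s) (at_right 0)"
    unfolding frequently_def
  proof
    assume "eventually (\<lambda>s. f s \<noteq> g s) (at_right 0)"
    then obtain b where b: "0 < b" "\<And>s. 0 < s \<Longrightarrow> s < b \<Longrightarrow> f s \<noteq> g s"
      by (auto simp: eventually_at_right[of 0 1, simplified])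
    define c where "c = min b t"
    have "AE s in lborel. s \<notin> {0<..<c}"
      using AE' by eventually_elim (use b(2) in \<open>auto simp: c_def I_def\<close>)
    then have "emeasure lborel {0<..<c} = 0"
      by (subst (asm) AE_iff_measurable[OF _ refl]) (auto simp: Int_def greaterThanLessThan_def)
    then show False using b(1) t(1) by (auto simp: c_def)
  qed
  define G where "G = inf (at_right 0) (principal {s. f s = g s})"
  have G: "G \<le> at_right 0" "G \<noteq> bot"
    using freq by (auto simp: G_def trivial_limit_def eventually_inf_principal frequently_def)
  have "(\<lambda>s. L * s powr \<alpha>) \<sim>[G] f" "g \<sim>[G] (\<lambda>s. M * s powr \<beta>)"
    using asymp_equiv_symI[OF f(5)] g(5) tendsto_mono[OF G(1)] unfolding asymp_equiv_def by blast+
  moreover have "eventually (\<lambda>s. f s = g s) G"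
    by (simp add: G_def eventually_inf_principal)
  then have "f \<sim>[G] g" by (rule asymp_equiv_refl_ev)
  ultimately have "(\<lambda>s. L * s powr \<alpha>) \<sim>[G] (\<lambda>s. M * s powr \<beta>)"
    by (blast intro: asymp_equiv_trans)
  then show ?thesis using A1_unique_aux[OF G LM] by blast
qed

lemma single_valued_over_L_iff:
  "single_valued_over L_functional N \<longleftrightarrow> (\<forall>P\<in>N. \<exists>\<alpha> L. A1 (fst P) \<alpha> L)"
  unfolding single_valued_over_def L_functional_def using A1_unique by blast

lemma single_valued_over_p: "single_valued_over (p_functional \<tau>) N"
  by (auto simp: single_valued_over_def p_functional_def)

lemma val_L_functional: "A1 (fst P) \<alpha> L \<Longrightarrow> val L_functional P = L"
  unfolding val_def L_functional_def using A1_unique by blast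

lemma val_p_functional: "val (p_functional \<tau>) P = measure (fst P) {0..\<tau>}"
  by (simp add: val_def p_functional_def)


section \<open>Estimators, risk and consistency\<close>

text \<open>A sample of size $n$ is a function on \<^term>\<open>{..<n}\<close>.  As $[0,\infty]$ is second countable,
  the Borel sets of $[0,\infty]^n$ are those of the product \<open>\<sigma>\<close>-algebra.\<close>

definition estimators :: "nat \<Rightarrow> ((nat \<Rightarrow> ennreal) \<Rightarrow> real) set" where
  "estimators n = borel_measurable (\<Pi>\<^sub>M i\<in>{..<n}. borel)"

definition sample_law :: "nat \<Rightarrow> law_kernel \<Rightarrow> (nat \<Rightarrow> ennreal) measure" where
  "sample_law n P = (\<Pi>\<^sub>M i\<in>{..<n}. observed_law P)"

definition risk :: "functional \<Rightarrow> nat \<Rightarrow> ((nat \<Rightarrow> ennreal) \<Rightarrow> real) \<Rightarrow> law_kernel \<Rightarrow> ennreal" where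
  "risk \<phi> n e P = (\<integral>\<^sup>+ x. ennreal \<bar>e x - val \<phi> P\<bar> \<partial>sample_law n P)"

definition deviation_prob ::
  "functional \<Rightarrow> nat \<Rightarrow> ((nat \<Rightarrow> ennreal) \<Rightarrow> real) \<Rightarrow> real \<Rightarrow> law_kernel \<Rightarrow> ennreal" where
  "deviation_prob \<phi> n e \<epsilon> P =
     emeasure (sample_law n P) {x \<in> space (sample_law n P). \<epsilon> \<le> \<bar>e x - val \<phi> P\<bar>}"

text \<open>Estimator sequences start at sample size 1; their value at index 0 is unconstrained and
  plays no role.\<close>

definition estimator_sequence :: "(nat \<Rightarrow> (nat \<Rightarrow> ennreal) \<Rightarrow> real) \<Rightarrow> bool" where
  "estimator_sequence e \<longleftrightarrow> (\<forall>n\<ge>1. e n \<in> estimators n)"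

definition uniformly_consistent_in_risk ::
  "(nat \<Rightarrow> (nat \<Rightarrow> ennreal) \<Rightarrow> real) \<Rightarrow> functional \<Rightarrow> law_kernel set \<Rightarrow> bool" where
  "uniformly_consistent_in_risk e \<phi> N \<longleftrightarrow>
     (\<lambda>n. SUP P\<in>N. risk \<phi> n (e n) P) \<longlonglongrightarrow> 0"

definition uniformly_consistent_in_probability ::
  "(nat \<Rightarrow> (nat \<Rightarrow> ennreal) \<Rightarrow> real) \<Rightarrow> functional \<Rightarrow> law_kernel set \<Rightarrow> bool" where
  "uniformly_consistent_in_probability e \<phi> N \<longleftrightarrow>
     (\<forall>\<epsilon>>0. (\<lambda>n. SUP P\<in>N. deviation_prob \<phi> n (e n) \<epsilon> P) \<longlonglongrightarrow> 0)"

definition pointwise_consistent_at ::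
  "(nat \<Rightarrow> (nat \<Rightarrow> ennreal) \<Rightarrow> real) \<Rightarrow> functional \<Rightarrow> law_kernel \<Rightarrow> bool" where
  "pointwise_consistent_at e \<phi> P \<longleftrightarrow>
     (\<forall>\<epsilon>>0. (\<lambda>n. deviation_prob \<phi> n (e n) \<epsilon> P) \<longlonglongrightarrow> 0)"

end

theory Submission
  imports Defs
begin

text \<open>The two witnesses have the same observed law, hence the same sample law, so an estimator
  cannot tell them apart.  Integrating \<open>\<bar>a - b\<bar> \<le> \<bar>e x - a\<bar> + \<bar>e x - b\<bar>\<close> against
  this common law shows that the two risks add up to at least \<open>\<Delta>\<close>; likewise, any outcome is
  at distance at least \<open>\<Delta> / 2\<close> from one of the two values, so the two deviation probabilities
  at \<open>\<Delta> / 2\<close> add up to at least 1.\<close>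

lemma (in prob_space) two_point_integral_bound:
  fixes e :: "'a \<Rightarrow> real"
  assumes [measurable]: "e \<in> borel_measurable M"
  shows "ennreal \<bar>a - b\<bar> \<le> (\<integral>\<^sup>+ x. ennreal \<bar>e x - a\<bar> \<partial>M) + (\<integral>\<^sup>+ x. ennreal \<bar>e x - b\<bar> \<partial>M)"
proof -
  have "ennreal \<bar>a - b\<bar> = (\<integral>\<^sup>+ x. ennreal \<bar>a - b\<bar> \<partial>M)"
    by (simp add: emeasure_space_1)
  also have "\<dots> \<le> (\<integral>\<^sup>+ x. ennreal \<bar>e x - a\<bar> + ennreal \<bar>e x - b\<bar> \<partial>M)"
    \<comment> \<open>Merging the two \<open>ennreal\<close> terms into one turns the claim into the
      real triangle inequality.\<close>
    by (intro nn_integral_mono) (simp flip: ennreal_plus)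
  also have "\<dots> = (\<integral>\<^sup>+ x. ennreal \<bar>e x - a\<bar> \<partial>M) + (\<integral>\<^sup>+ x. ennreal \<bar>e x - b\<bar> \<partial>M)"
    by (intro nn_integral_add) auto
  finally show ?thesis .
qed

lemma (in prob_space) two_point_deviation_bound:
  fixes e :: "'a \<Rightarrow> real"
  assumes [measurable]: "e \<in> borel_measurable M"
  shows "1 \<le> emeasure M {x \<in> space M. \<bar>a - b\<bar> / 2 \<le> \<bar>e x - a\<bar>}
           + emeasure M {x \<in> space M. \<bar>a - b\<bar> / 2 \<le> \<bar>e x - b\<bar>}" (is "1 \<le> emeasure M ?A + emeasure M ?B")
proof -
  have "\<bar>a - b\<bar> / 2 \<le> \<bar>e x - a\<bar> \<or> \<bar>a - b\<bar> / 2 \<le> \<bar>e x - b\<bar>" for x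
    \<comment> \<open>\<open>e x\<close> cancels in \<open>(e x - b) - (e x - a) = a - b\<close>.
      The non-strict inequality in the events also covers the midpoint of \<open>a\<close> and
      \<open>b\<close>.\<close>
    using abs_triangle_ineq4[of "e x - b" "e x - a"] by (auto simp: field_simps)
  then have cover: "space M \<subseteq> ?A \<union> ?B" by blast
  have "1 = emeasure M (space M)"
    by (simp add: emeasure_space_1)
  also have "\<dots> \<le> emeasure M (?A \<union> ?B)"
    by (intro emeasure_mono cover) auto
  also have "\<dots> \<le> emeasure M ?A + emeasure M ?B"
    by (intro emeasure_subadditive) auto
  finally show ?thesis .
qed

text \<open>The larger of two numbers is at least half their sum. Arguing by contradiction avoids
  subtraction, as \<open>u\<close>, \<open>v\<close> and \<open>S\<close> may be infinite.\<close>

lemma half_le_if_le_add: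
  fixes u v S :: ennreal
  assumes "ennreal c \<le> u + v" "u \<le> S" "v \<le> S"
  shows "ennreal (c / 2) \<le> S"
proof (rule ccontr)
  assume "\<not> ennreal (c / 2) \<le> S"
  then have "S < ennreal (c / 2)" by simp
  then have "S + S < ennreal (c / 2) + ennreal (c / 2)"
    by (intro add_strict_mono)
  \<comment> \<open>The sign of \<open>c\<close> is not assumed. For negative \<open>c\<close> the
    cast \<open>ennreal (c / 2)\<close> is 0, and nothing lies strictly below 0.\<close>
  moreover have "0 \<le> c / 2"
    using \<open>S < ennreal (c / 2)\<close> by (metis ennreal_neg linorder_le_cases not_less_zero)
  then have "ennreal (c / 2) + ennreal (c / 2) = ennreal c"
    by (simp flip: ennreal_plus)
  moreover have "u + v \<le> S + S"
    using assms by (intro add_mono)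
  ultimately show False
    using assms(1) by (metis leD order_trans)
qed

lemma prob_space_sample_law: "is_pair P \<Longrightarrow> prob_space (sample_law n P)"
  unfolding sample_law_def
  by (intro prob_space_PiM) (metis prob_space_observed_law(1) prod.collapse)

lemma borel_measurable_sample_law:
  assumes "is_pair P" "e \<in> estimators n"
  shows "e \<in> borel_measurable (sample_law n P)"
proof -
  have "sets (observed_law P) = sets borel"
    using assms(1) by (metis prob_space_observed_law(2) prod.collapse)
  then have "sets (sample_law n P) = sets (\<Pi>\<^sub>M i\<in>{..<n}. borel)"
    unfolding sample_law_def by (intro sets_PiM_cong) auto
  then show ?thesis
    using assms(2) unfolding estimators_def by (simp cong: measurable_cong_sets)
qed

lemma sample_law_cong: "observed_law P = observed_law P' \<Longrightarrow> sample_law n P = sample_law n P'"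
  by (simp add: sample_law_def)

context
  fixes P P' :: law_kernel
  assumes pair: "is_pair P" and same_law: "observed_law P = observed_law P'"
begin

text \<open>Both risks integrate over one sample law, a probability space since \<open>P\<close> is
  a pair. The two-point bound applies with the two values as \<open>a\<close> and
  \<open>b\<close>.\<close>

lemma risk_add_lower_bound:
  assumes "e \<in> estimators n"
  shows "ennreal \<bar>val \<phi> P - val \<phi> P'\<bar> \<le> risk \<phi> n e P + risk \<phi> n e P'"
  using prob_space.two_point_integral_bound[OF prob_space_sample_law[OF pair]
      borel_measurable_sample_law[OF pair assms]]
  unfolding risk_def by (simp add: sample_law_cong[OF same_law])

lemma deviation_prob_add_lower_bound:
  assumes "e \<in> estimators n"
  shows "1 \<le> deviation_prob \<phi> n e (\<bar>val \<phi> P - val \<phi> P'\<bar> / 2) P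
           + deviation_prob \<phi> n e (\<bar>val \<phi> P - val \<phi> P'\<bar> / 2) P'"
  using prob_space.two_point_deviation_bound[OF prob_space_sample_law[OF pair]
      borel_measurable_sample_law[OF pair assms]]
  unfolding deviation_prob_def by (simp add: sample_law_cong[OF same_law])

text \<open>The supremum dominates both risks, whose sum is at least the gap between the
  values.\<close>

lemma SUP_risk_lower_bound:
  assumes "e \<in> estimators n" "P \<in> N" "P' \<in> N"
  shows "ennreal (\<bar>val \<phi> P - val \<phi> P'\<bar> / 2) \<le> (SUP P\<in>N. risk \<phi> n e P)"
  by (rule half_le_if_le_add[OF risk_add_lower_bound[OF assms(1)]]) (auto intro: SUP_upper assms)

lemma not_pointwise_consistent_at_both:
  assumes "val \<phi> P \<noteq> val \<phi> P'" "estimator_sequence e"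
    "pointwise_consistent_at e \<phi> P" "pointwise_consistent_at e \<phi> P'"
  shows False
proof -
  define \<epsilon> where "\<epsilon> = \<bar>val \<phi> P - val \<phi> P'\<bar> / 2"
  have "0 < \<epsilon>" using assms(1) by (simp add: \<epsilon>_def)
  then have "(\<lambda>n. deviation_prob \<phi> n (e n) \<epsilon> P + deviation_prob \<phi> n (e n) \<epsilon> P') \<longlonglongrightarrow> 0 + 0"
    using assms(3,4) unfolding pointwise_consistent_at_def by (intro tendsto_add) auto
  \<comment> \<open>Measurability of \<open>e n\<close> is known only from index 1 on, and a bound
    that holds eventually passes to the limit.\<close>
  moreover have "\<forall>n\<ge>1. 1 \<le> deviation_prob \<phi> n (e n) \<epsilon> P + deviation_prob \<phi> n (e n) \<epsilon> P'"
    using assms(2) deviation_prob_add_lower_bound unfolding estimator_sequence_def \<epsilon>_def by blast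
  ultimately have "(1 :: ennreal) \<le> 0 + 0"
    by (intro LIMSEQ_le_const) blast+
  then show False by simp
qed

end

text \<open>This reduces uniform failure in probability to pointwise failure at the witnesses: each
  member's deviation probability is squeezed between 0 and the supremum.\<close>

lemma uniformly_consistent_in_probability_imp_pointwise:
  assumes "uniformly_consistent_in_probability e \<phi> N" "P \<in> N"
  shows "pointwise_consistent_at e \<phi> P"
  unfolding pointwise_consistent_at_def
proof (intro allI impI)
  fix \<epsilon> :: real assume "0 < \<epsilon>"
  then have "(\<lambda>n. SUP P\<in>N. deviation_prob \<phi> n (e n) \<epsilon> P) \<longlonglongrightarrow> 0"
    using assms(1) by (simp add: uniformly_consistent_in_probability_def)
  then show "(\<lambda>n. deviation_prob \<phi> n (e n) \<epsilon> P) \<longlonglongrightarrow> 0"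
    by (rule tendsto_sandwich[OF _ _ tendsto_const, rotated -1]) (auto intro!: always_eventually SUP_upper assms(2))
qed

theorem lemma4p6:
  fixes \<tau> :: real and \<phi> :: functional and N :: "law_kernel set"
    and F\<^sub>0 F\<^sub>1 :: "real measure" and K\<^sub>0 K\<^sub>1 :: "real \<Rightarrow> ennreal measure" and \<Delta> :: real
  assumes "0 < \<tau>"
    and "\<phi> \<in> {L_functional, p_functional \<tau>}"
    and "\<forall>P\<in>N. is_pair P"
    and "single_valued_over \<phi> N"
    and "\<not> identifiable \<phi> N"
    and "(F\<^sub>0, K\<^sub>0) \<in> N" and "(F\<^sub>1, K\<^sub>1) \<in> N"
    and "observed_law (F\<^sub>0, K\<^sub>0) = observed_law (F\<^sub>1, K\<^sub>1)"
    and "val \<phi> (F\<^sub>0, K\<^sub>0) \<noteq> val \<phi> (F\<^sub>1, K\<^sub>1)"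
    and "\<Delta> = \<bar>val \<phi> (F\<^sub>0, K\<^sub>0) - val \<phi> (F\<^sub>1, K\<^sub>1)\<bar>"
  shows "0 < \<Delta>
    \<and> (\<forall>n\<ge>1. \<forall>e\<in>estimators n. ennreal (\<Delta> / 2) \<le> (SUP P\<in>N. risk \<phi> n e P))
    \<and> (\<forall>n\<ge>1. ennreal (\<Delta> / 2) \<le> (INF e\<in>estimators n. SUP P\<in>N. risk \<phi> n e P)
              \<and> 0 < ennreal (\<Delta> / 2))
    \<and> (\<nexists>e. estimator_sequence e \<and> uniformly_consistent_in_risk e \<phi> N)
    \<and> (\<nexists>e. estimator_sequence e \<and> uniformly_consistent_in_probability e \<phi> N)
    \<and> (\<forall>n\<ge>1. \<forall>e\<in>estimators n.
         distr (sample_law n (F\<^sub>0, K\<^sub>0)) borel e = distr (sample_law n (F\<^sub>1, K\<^sub>1)) borel e)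
    \<and> (\<nexists>e. estimator_sequence e
             \<and> pointwise_consistent_at e \<phi> (F\<^sub>0, K\<^sub>0) \<and> pointwise_consistent_at e \<phi> (F\<^sub>1, K\<^sub>1))"
proof -
  let ?P = "(F\<^sub>0, K\<^sub>0)" and ?P' = "(F\<^sub>1, K\<^sub>1)"
  have pair: "is_pair ?P" using assms(3,6) by blast
  have pos: "0 < \<Delta>" using assms(9,10) by simp
  have bound: "ennreal (\<Delta> / 2) \<le> (SUP P\<in>N. risk \<phi> n e P)" if "e \<in> estimators n" for n e
    using SUP_risk_lower_bound[OF pair assms(8) that assms(6,7)] assms(10) by simp
  have no_risk: False if "estimator_sequence e" "uniformly_consistent_in_risk e \<phi> N" for e
  proof -
    have "\<forall>n\<ge>1. ennreal (\<Delta> / 2) \<le> (SUP P\<in>N. risk \<phi> n (e n) P)"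
      using that(1) bound unfolding estimator_sequence_def by blast
    \<comment> \<open>A lower bound independent of \<open>n\<close> survives in the limit, which
      uniform consistency says is 0.\<close>
    then have "ennreal (\<Delta> / 2) \<le> 0"
      using that(2) unfolding uniformly_consistent_in_risk_def by (intro LIMSEQ_le_const) blast+
    then show False using pos by (simp add: ennreal_eq_0_iff)
  qed
  note no_pointwise = not_pointwise_consistent_at_both[OF pair assms(8,9)]
  have no_prob: False if "estimator_sequence e" "uniformly_consistent_in_probability e \<phi> N" for e
    using no_pointwise[OF that(1)] uniformly_consistent_in_probability_imp_pointwise[OF that(2)]
      assms(6,7) by blast
  have inf: "ennreal (\<Delta> / 2) \<le> (INF e\<in>estimators n. SUP P\<in>N. risk \<phi> n e P)" for n
    by (intro INF_greatest bound)
  \<comment> \<open>These are push-forwards of one and the same measure under the same map.\<close>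
  have distr: "distr (sample_law n ?P) borel e = distr (sample_law n ?P') borel e"
    for n and e :: "(nat \<Rightarrow> ennreal) \<Rightarrow> real"
    by (simp only: sample_law_cong[OF assms(8)])
  have half: "0 < ennreal (\<Delta> / 2)" using pos by simp
  show ?thesis
    using pos half bound inf no_risk no_prob distr no_pointwise by blast
qed

end
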